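(* For every integer $d\ge 1$ there exists $n_0(d)$ such that for all $n\ge n_0(d)$, \[ (d+1)! \le \mathrm{HG}(B_{d,n}) \le d^{d-2}(d^2+d-1)+1. \]
   Context: Hat guessing game: players sit on the vertices of a finite simple graph $G$; an adversary places on each vertex a hat of one of $q$ colors. Each player sees only the hat colors of its neighbors (not its own) and, following a strategy agreed in advance (a deterministic function of the colors it sees), guesses its own hat color; all guess simultaneously. The players win if at least one player guesses correctly. The hat guessing number $\mathrm{HG}(G)$ is the largest $q$ for which the players have a strategy that wins for every hat assignment with $q$ colors. The book graph $B_{d,n}$ is obtained from the complete graph $K_{n+d}$ by removing the edges of an $n$-clique; i.e. it consists of a $d$-clique (the spine) with every spine vertex adjacent to each of $n$ further pairwise non-adjacent vertices (the pages). *)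

theory Defs
  imports Complex_Main "HOL-Library.FuncSet"
begin

text \<open>
  A finite simple graph is given by a vertex set \<open>V\<close> and a set \<open>E\<close> of two-element subsets of \<open>V\<close>.
\<close>

definition all_edges :: "'a set \<Rightarrow> 'a set set" where
  "all_edges V = {e. e \<subseteq> V \<and> card e = 2}"

definition nbhd :: "'a set \<Rightarrow> 'a set set \<Rightarrow> 'a \<Rightarrow> 'a set" where
  "nbhd V E v = {u \<in> V. {u, v} \<in> E}"

text \<open>
  The colours are \<open>{..<q}\<close>. A strategy gives every vertex a function from the colourings of its
  neighbourhood to the colours. Such a colouring is extensional, that is \<open>undefined\<close> off the
  neighbourhood, so it carries no information about any other hat.
\<close>

definition strategies :: "'a set \<Rightarrow> 'a set set \<Rightarrow> nat \<Rightarrow> ('a \<Rightarrow> ('a \<Rightarrow> nat) \<Rightarrow> nat) set" where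
  "strategies V E q = (\<Pi> v\<in>V. (nbhd V E v \<rightarrow>\<^sub>E {..<q}) \<rightarrow> {..<q})"

definition players_win :: "'a set \<Rightarrow> 'a set set \<Rightarrow> nat \<Rightarrow> bool" where
  "players_win V E q \<longleftrightarrow>
    (\<exists>s \<in> strategies V E q. \<forall>c \<in> V \<rightarrow>\<^sub>E {..<q}.
      \<exists>v\<in>V. s v (restrict c (nbhd V E v)) = c v)"

text \<open>
  The greatest value exists when \<open>V\<close> is finite and nonempty: \<open>q = 1\<close> always wins, and averaging
  the number of correct guesses over all colourings shows that a winning \<open>q\<close> is at most \<open>card V\<close>.
\<close>

definition HG :: "'a set \<Rightarrow> 'a set set \<Rightarrow> nat" where
  "HG V E = (GREATEST q. players_win V E q)"

text \<open>
  In the book graph the spine is \<open>{0..<d}\<close> and the pages are \<open>{d..<d + n}\<close>.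
\<close>

definition book_verts :: "nat \<Rightarrow> nat \<Rightarrow> nat set" where
  "book_verts d n = {0..<d + n}"

definition book_edges :: "nat \<Rightarrow> nat \<Rightarrow> nat set set" where
  "book_edges d n = all_edges (book_verts d n) - all_edges {d..<d + n}"

end

theory Submission
  imports Defs
begin

text \<open>
  A set of at most \<open>q - 1\<close> spine colourings can always be made to survive: each page then has a
  colour it never guesses on this set. Conversely, if the pages use all possible guessing functions,
  then at most \<open>q - 1\<close> spine colourings survive. So the game reduces to finding out which sets \<open>S\<close>
  of points of \<open>\<nat>\<^sup>d\<close> can be covered by the spine, where the spine selects one point on each
  axis-parallel line.

  For the upper bound, the box with sides \<open>d, \<dots>, d, d + 1\<close> has more points than lines, so any
  subset with one point more than the number \<open>d ^ (d - 2) * (d\<^sup>2 + d - 1)\<close> of lines cannot be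
  covered. For the lower bound, Hall's theorem reduces covering to the inequality
  \<open>card S \<le> (\<Sum>i. card (\<pi>\<^sub>i S))\<close> for the projections along the axes, which holds for
  \<open>card S \<le> d ^ d\<close> by a Loomis-Whitney type argument. This includes all sizes below \<open>(d + 1)!\<close>
  unless \<open>d = 2\<close>, where the same inequality and integrality handle \<open>card S = 5\<close>.
\<close>

section \<open>Hall's marriage theorem\<close>

text \<open>If a nonempty proper subset \<open>S\<close> meets Hall's condition with equality, the
  remaining elements keep the condition after the neighbours \<open>U\<close> of \<open>S\<close>
  are removed, so both parts can be matched by induction. Otherwise every nonempty proper subset has
  a neighbour to spare, and any single pair can be matched and removed.\<close>

lemma hall_marriage:
  assumes "finite A" "\<And>x. x \<in> A \<Longrightarrow> finite (L x)"
    and "\<And>S. S \<subseteq> A \<Longrightarrow> card S \<le> card (\<Union>(L ` S))"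
  shows "\<exists>h. inj_on h A \<and> (\<forall>x\<in>A. h x \<in> L x)"
  using assms
proof (induction "card A" arbitrary: A L rule: less_induct)
  case less
  note fin = less.prems(1) and finL = less.prems(2) and hall = less.prems(3)
  show ?case
  proof (cases "\<exists>S. S \<noteq> {} \<and> S \<subset> A \<and> card S = card (\<Union>(L ` S))")
    case True
    then obtain S where S: "S \<noteq> {}" "S \<subset> A" "card S = card (\<Union>(L ` S))" by blast
    define U where "U = \<Union>(L ` S)"
    have finS: "finite S" using S fin finite_subset by blast
    have finU: "finite U" unfolding U_def using S finL finS by blast
    have "\<exists>h. inj_on h S \<and> (\<forall>x\<in>S. h x \<in> L x)"
    proof (rule less.hyps)
      show "card S < card A" using S fin by (intro psubset_card_mono)
      show "card W \<le> card (\<Union>(L ` W))" if "W \<subseteq> S" for W using that S by (intro hall) auto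
    qed (use S finS finL in auto)
    then obtain h where h: "inj_on h S" "\<forall>x\<in>S. h x \<in> L x" by blast
    have "\<exists>h. inj_on h (A - S) \<and> (\<forall>x\<in>A-S. h x \<in> L x - U)"
    proof (rule less.hyps)
      show "card (A - S) < card A" using S fin by (intro psubset_card_mono) auto
      fix W assume W: "W \<subseteq> A - S"
      have finW: "finite W" using W fin finite_subset by blast
      have "card W + card S = card (W \<union> S)" using W finW finS by (subst card_Un_disjoint) auto
      also have "\<dots> \<le> card (\<Union>(L ` (W \<union> S)))" using W S by (intro hall) auto
      also have "\<Union>(L ` (W \<union> S)) = (\<Union>x\<in>W. L x - U) \<union> U" unfolding U_def by auto
      also have "card \<dots> \<le> card (\<Union>x\<in>W. L x - U) + card U" by (rule card_Un_le)
      finally show "card W \<le> card (\<Union>x\<in>W. L x - U)" using S(3) unfolding U_def by simp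
    qed (use fin finL in auto)
    then obtain k where k: "inj_on k (A - S)" "\<forall>x\<in>A-S. k x \<in> L x - U" by blast
    have hU: "h x \<in> U" if "x \<in> S" for x using h that unfolding U_def by auto
    have kU: "k x \<notin> U" if "x \<in> A - S" for x using k that by auto
    show ?thesis
    proof (intro exI conjI ballI)
      show "inj_on (\<lambda>x. if x \<in> S then h x else k x) A"
        using h(1) k(1) hU kU unfolding inj_on_def by (metis DiffI)
    qed (use h k in auto)
  next
    case False
    show ?thesis
    proof (cases "A = {}")
      case ne: False
      then obtain x where x: "x \<in> A" by blast
      have "L x \<noteq> {}" using hall[of "{x}"] x by auto
      then obtain y where y: "y \<in> L x" by blast
      have "\<exists>h. inj_on h (A - {x}) \<and> (\<forall>z\<in>A-{x}. h z \<in> L z - {y})"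
      proof (rule less.hyps)
        show "card (A - {x}) < card A" using x fin by (intro psubset_card_mono) auto
        fix W assume W: "W \<subseteq> A - {x}"
        show "card W \<le> card (\<Union>z\<in>W. L z - {y})"
        proof (cases "W = {}")
          case W0: False
          have "W \<subset> A" using W x by auto
          then have "card W < card (\<Union>(L ` W))"
            using False W0 hall[of W] by (meson le_neq_implies_less psubset_imp_subset)
          also have "\<Union>(L ` W) \<subseteq> insert y (\<Union>z\<in>W. L z - {y})" by auto
          then have "card (\<Union>(L ` W)) \<le> card (insert y (\<Union>z\<in>W. L z - {y}))"
            using W fin finL finite_subset[OF W] by (intro card_mono) auto
          also have "\<dots> \<le> Suc (card (\<Union>z\<in>W. L z - {y}))"
            by (rule card_insert_le_m1) auto
          finally show ?thesis by simp
        qed auto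
      qed (use fin finL in auto)
      then obtain h where h: "inj_on h (A - {x})" "\<forall>z\<in>A-{x}. h z \<in> L z - {y}" by blast
      have "inj_on (h(x := y)) A"
        using h unfolding inj_on_def by (metis Diff_iff fun_upd_apply insertE insertI1 emptyE)
      then show ?thesis using h y by (intro exI[of _ "h(x := y)"]) auto
    qed auto
  qed
qed

section \<open>A Loomis-Whitney inequality by slicing\<close>

text \<open>The arithmetic of the induction on the dimension: \<open>N\<close> counts points,
  \<open>P\<close> is the projection along the new axis, \<open>Q\<close> the sum of the other
  projections, and \<open>r ^ k\<close> will bound the size of every layer.\<close>

lemma bernoulli_step:
  fixes m r N P Q :: real
  assumes "0 < m" "0 < r" "0 \<le> N" "N \<le> m ^ Suc k" "r ^ k \<le> P" "real k * N \<le> r * Q"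
  shows "real (Suc k) * N \<le> m * (P + Q)"
proof -
  \<comment> \<open>Bernoulli's inequality for \<open>(r / m) ^ Suc k\<close> gives this with
    \<open>m ^ Suc k\<close> in place of \<open>N\<close>. Passing to the smaller \<open>N\<close>
    needs a nonnegative bracket, hence the case split.\<close>
  have *: "N * (real (Suc k) * r - m * real k) \<le> m * r ^ Suc k"
  proof (cases "real (Suc k) * r - m * real k \<le> 0")
    case True
    then have "N * (real (Suc k) * r - m * real k) \<le> 0"
      using assms by (simp add: mult_nonneg_nonpos)
    also have "0 \<le> m * r ^ Suc k" using assms by simp
    finally show ?thesis .
  next
    case False
    have "1 + real (Suc k) * (r / m - 1) \<le> (1 + (r / m - 1)) ^ Suc k"
      using assms by (intro Bernoulli_inequality) simp
    then have "m ^ Suc (Suc k) * (1 + real (Suc k) * (r / m - 1)) \<le> m ^ Suc (Suc k) * (r / m) ^ Suc k"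
      using assms by (intro mult_left_mono) auto
    also have "\<dots> = m * r ^ Suc k" using assms by (simp add: power_divide)
    also have "m ^ Suc (Suc k) * (1 + real (Suc k) * (r / m - 1))
        = m ^ Suc k * (real (Suc k) * r - m * real k)"
      using assms by (simp add: field_simps)
    finally have "m ^ Suc k * (real (Suc k) * r - m * real k) \<le> m * r ^ Suc k" .
    moreover have "N * (real (Suc k) * r - m * real k) \<le> m ^ Suc k * (real (Suc k) * r - m * real k)"
      using assms False by (intro mult_right_mono) auto
    ultimately show ?thesis by linarith
  qed
  have "r * (real (Suc k) * N) \<le> m * (r * r ^ k) + m * (real k * N)"
    using * by (simp add: algebra_simps)
  also have "\<dots> \<le> m * (r * P) + m * (r * Q)"
    using assms by (intro add_mono mult_left_mono) auto
  also have "\<dots> = r * (m * (P + Q))" by (simp add: algebra_simps)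
  finally show ?thesis using assms(2) by simp
qed

text \<open>
  A Loomis-Whitney inequality: with \<open>m = (card S) powr (1 / card I)\<close> it bounds the mean of the
  projection sizes from below by \<open>(card S) powr (1 - 1 / card I)\<close>. A free \<open>m\<close> keeps roots out of
  the statement. Overwriting coordinate \<open>i\<close> with a fixed value \<open>u\<close> plays the role of the projection
  along axis \<open>i\<close>.
\<close>

lemma sum_card_projections_ge:
  fixes m :: real and u :: 'b
  assumes "finite I" "finite S" "0 < m"
    and "\<And>x y j. x \<in> S \<Longrightarrow> y \<in> S \<Longrightarrow> j \<notin> I \<Longrightarrow> x j = y j"
    and "card S \<le> m ^ card I"
  shows "real (card I) * card S \<le> m * (\<Sum>i\<in>I. card ((\<lambda>x. x(i := u)) ` S))"
  using assms
proof (induction I arbitrary: S m rule: finite_induct)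
  case empty
  then show ?case by simp
next
  case (insert a I)
  note fin = insert.prems(1) and m = insert.prems(2) and agree = insert.prems(3)
    and bound = insert.prems(4)
  define \<pi> where "\<pi> i S = (\<lambda>x. x(i := u)) ` S" for i and S :: "('a \<Rightarrow> 'b) set"
  define layer where "layer v = {x \<in> S. x a = v}" for v
  define V where "V = (\<lambda>x. x a) ` S"
  define k where "k = card I"
  define Q where "Q = (\<Sum>i\<in>I. card (\<pi> i S))"
  have cI: "card (insert a I) = Suc k" using insert.hyps k_def by simp
  have finV: "finite V" and finl: "finite (layer v)" for v
    using fin V_def layer_def by auto
  have S_eq: "S = (\<Union>v\<in>V. layer v)" unfolding V_def layer_def by auto
  have card_S: "card S = (\<Sum>v\<in>V. card (layer v))"
    by (subst S_eq, rule card_UN_disjoint) (use finV finl in \<open>auto simp: layer_def\<close>)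
  have card_\<pi>: "card (\<pi> i S) = (\<Sum>v\<in>V. card (\<pi> i (layer v)))" if "i \<in> I" for i
  proof -
    have ia: "i \<noteq> a" using that insert.hyps by auto
    have "\<pi> i S = (\<Union>v\<in>V. \<pi> i (layer v))" unfolding \<pi>_def by (subst S_eq) auto
    moreover have "\<pi> i (layer v) \<inter> \<pi> i (layer w) = {}" if "v \<noteq> w" for v w
    proof -
      have "z a = v" if "z \<in> \<pi> i (layer v)" for z v
        using that ia unfolding \<pi>_def layer_def by auto
      then show ?thesis using that by blast
    qed
    ultimately show ?thesis
      using finV finl by (simp add: card_UN_disjoint \<pi>_def)
  qed
  have Q: "Q = (\<Sum>v\<in>V. \<Sum>i\<in>I. card (\<pi> i (layer v)))"
    unfolding Q_def using card_\<pi> by (simp add: sum.swap[of _ V I])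
  have layer_agree: "x j = y j" if "x \<in> layer v" "y \<in> layer v" "j \<notin> I" for x y j v
    using that agree[of x y j] unfolding layer_def by (cases "j = a") auto
  \<comment> \<open>Coordinate \<open>a\<close> is constant on a layer, so overwriting it is
    injective there.\<close>
  have layer_le: "card (layer v) \<le> card (\<pi> a S)" for v
  proof (rule card_inj_on_le[of "\<lambda>x. x(a := u)"])
    show "inj_on (\<lambda>x. x(a := u)) (layer v)"
      unfolding inj_on_def layer_def by (auto simp: fun_eq_iff fun_upd_def split: if_splits) metis
    show "(\<lambda>x. x(a := u)) ` layer v \<subseteq> \<pi> a S" unfolding \<pi>_def layer_def by auto
  qed (use fin \<pi>_def in auto)
  have goal: "real (Suc k) * card S \<le> m * (real (card (\<pi> a S)) + real Q)"
  proof (cases "S = {}")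
    case False
    have P1: "card (\<pi> a S) \<ge> 1"
      using False fin unfolding \<pi>_def by (simp add: Suc_leI card_gt_0_iff)
    \<comment> \<open>As \<open>r ^ k\<close> is the size of the projection along \<open>a\<close>,
      \<open>layer_le\<close> lets the induction hypothesis be applied to each layer with
      \<open>r\<close> for \<open>m\<close>. For \<open>k = 0\<close> there is no such root, and any
      positive value serves.\<close>
    define r where "r = (if k = 0 then 1 else root k (card (\<pi> a S)))"
    have r0: "r > 0" using P1 unfolding r_def by auto
    have rk: "r ^ k = (if k = 0 then 1 else card (\<pi> a S))" unfolding r_def by auto
    show ?thesis
    proof (rule bernoulli_step[OF m r0])
      show "card S \<le> m ^ Suc k" using bound cI by metis
      show "r ^ k \<le> card (\<pi> a S)" using rk P1 by auto
      show "real k * card S \<le> r * Q"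
      proof (cases "k = 0")
        case False
        have "real k * card S = (\<Sum>v\<in>V. real k * card (layer v))"
          unfolding card_S by (simp add: sum_distrib_left)
        also have "\<dots> \<le> (\<Sum>v\<in>V. r * (\<Sum>i\<in>I. card (\<pi> i (layer v))))"
        proof (rule sum_mono)
          fix v
          have "real (card (layer v)) \<le> r ^ k" using rk False layer_le[of v] by simp
          then show "real k * card (layer v) \<le> r * (\<Sum>i\<in>I. card (\<pi> i (layer v)))"
            unfolding k_def \<pi>_def using finl r0 layer_agree by (intro insert.IH) auto
        qed
        also have "\<dots> = r * Q" unfolding Q by (simp add: sum_distrib_left)
        finally show ?thesis .
      qed (use r0 in auto)
    qed auto
  qed (use m in auto)
  have "(\<Sum>i\<in>insert a I. card (\<pi> i S)) = card (\<pi> a S) + Q"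
    unfolding Q_def using insert.hyps by simp
  then have "real (\<Sum>i\<in>insert a I. card (\<pi> i S)) = card (\<pi> a S) + real Q" by simp
  then show ?case using goal unfolding cI \<pi>_def by presburger
qed

section \<open>Covering fewer than (d + 1)! points\<close>

text \<open>The step rests on \<open>d * (d + 2) \<le> (d + 1)\<^sup>2\<close>. The inequality fails
  for \<open>d = 1\<close> and \<open>d = 2\<close> (2 > 1 and 6 > 4), so these dimensions are
  treated apart below.\<close>

lemma fact_Suc_le_self_power: "3 \<le> d \<Longrightarrow> fact (d + 1) \<le> (d ^ d :: nat)"
proof (induction d rule: nat_induct_at_least)
  case base
  show ?case by (simp add: eval_nat_numeral)
next
  case (Suc d)
  then obtain e where e: "d = Suc e" by (cases d) auto
  have "fact (Suc d + 1) = (d + 2) * fact (d + 1)" by (simp add: algebra_simps)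
  also have "\<dots> \<le> (d + 2) * (d * d ^ e)" using Suc.IH e by (intro mult_left_mono) auto
  also have "\<dots> = (d * (d + 2)) * d ^ e" by (simp add: algebra_simps)
  also have "\<dots> \<le> (Suc d * Suc d) * Suc d ^ e"
    by (intro mult_mono[OF _ power_mono]) (auto simp: algebra_simps)
  also have "\<dots> = Suc d ^ Suc d" unfolding e power_Suc by (simp only: mult.assoc)
  finally show ?case .
qed

text \<open>This is Hall's condition for matching points to lines through them. Taking
  \<open>m = card I\<close> and cancelling \<open>card I\<close> proves it, except in dimension
  2.\<close>

lemma card_le_sum_card_projections:
  fixes S :: "('a \<Rightarrow> 'b) set" and u :: 'b
  assumes "finite I" "I \<noteq> {}" "finite S"
    and "\<And>x y j. x \<in> S \<Longrightarrow> y \<in> S \<Longrightarrow> j \<notin> I \<Longrightarrow> x j = y j"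
    and "card S < fact (card I + 1)"
  shows "card S \<le> (\<Sum>i\<in>I. card ((\<lambda>x. x(i := u)) ` S))" (is "_ \<le> ?P")
proof -
  have I1: "card I \<ge> 1" using assms by (simp add: Suc_leI card_gt_0_iff)
  have proj: "real (card I) * card S \<le> m * ?P" if "0 < m" "card S \<le> m ^ card I" for m :: real
    by (rule sum_card_projections_ge) (use assms that in blast)+
  show ?thesis
  proof (cases "card I = 2")
    case True
    have S5: "card S \<le> 5" using assms(5) True by (simp add: fact_numeral)
    \<comment> \<open>The constant \<open>9 / 4\<close> is just above the square root of 5, as
      \<open>81 / 16 > 5\<close>. The resulting factor \<open>8 / 9\<close> loses less than one
      point when \<open>card S \<le> 5\<close>, so integrality closes the gap.\<close>
    then have "real (card S) \<le> (9 / 4) ^ card I" unfolding True by (simp add: power2_eq_square)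
    then have "real (card I) * card S \<le> 9 / 4 * ?P" by (intro proj) auto
    then have "2 * real (card S) \<le> 9 / 4 * real ?P" unfolding True by simp
    then have "real (8 * card S) \<le> real (9 * ?P)" by simp
    then have "8 * card S \<le> 9 * ?P" by (simp only: of_nat_le_iff)
    then show ?thesis using S5 by linarith
  next
    case False
    have "card S \<le> card I ^ card I"
    proof (cases "card I = 1")
      case True
      then show ?thesis using assms(5) by simp
    next
      case False
      then have "3 \<le> card I" using I1 \<open>card I \<noteq> 2\<close> by linarith
      then show ?thesis using fact_Suc_le_self_power[of "card I"] assms(5) by linarith
    qed
    then have "real (card S) \<le> real (card I) ^ card I" by (metis of_nat_le_iff of_nat_power)
    then have "real (card I) * card S \<le> real (card I) * ?P" using I1 by (intro proj) auto
    then have "real (card S) \<le> real ?P" using I1 by (simp only: mult_le_cancel_left_pos of_nat_0_less_iff)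
    then show ?thesis by (simp only: of_nat_le_iff)
  qed
qed

text \<open>Hall's theorem gives each point of \<open>S\<close> a line of its own through it. A line
  is encoded by its direction \<open>i\<close> and a point with coordinate \<open>i\<close> erased,
  which is exactly what player \<open>i\<close> sees.\<close>

lemma complete_graph_strategy:
  fixes S :: "('a \<Rightarrow> 'b) set" and u :: 'b
  assumes "finite I" "I \<noteq> {}" "finite S"
    and "\<And>x y j. x \<in> S \<Longrightarrow> y \<in> S \<Longrightarrow> j \<notin> I \<Longrightarrow> x j = y j"
    and "card S < fact (card I + 1)"
  shows "\<exists>f. \<forall>x\<in>S. \<exists>i\<in>I. f i (x(i := u)) = x i"
proof -
  define L where "L x = (\<lambda>i. (i, x(i := u))) ` I" for x :: "'a \<Rightarrow> 'b"
  have "\<exists>h. inj_on h S \<and> (\<forall>x\<in>S. h x \<in> L x)"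
  proof (rule hall_marriage)
    fix W assume W: "W \<subseteq> S"
    have finW: "finite W" using W assms(3) finite_subset by blast
    have "card W \<le> card S" using W assms(3) card_mono by blast
    then have "card W \<le> (\<Sum>i\<in>I. card ((\<lambda>x. x(i := u)) ` W))"
    proof (intro card_le_sum_card_projections)
      show "x j = y j" if "x \<in> W" "y \<in> W" "j \<notin> I" for x y j
        using assms(4)[of x y j] that W by blast
    qed (use assms(1,2,5) finW \<open>card W \<le> card S\<close> in auto)
    also have "\<dots> = card (SIGMA i:I. (\<lambda>x. x(i := u)) ` W)"
      using assms(1) finW by (subst card_SigmaI) auto
    also have "(SIGMA i:I. (\<lambda>x. x(i := u)) ` W) = \<Union>(L ` W)" unfolding L_def by auto
    finally show "card W \<le> card (\<Union>(L ` W))" .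
  qed (use assms(1,3) L_def in auto)
  then obtain h where h: "inj_on h S" "\<forall>x\<in>S. h x \<in> L x" by blast
  show ?thesis
  \<comment> \<open>Player \<open>i\<close> guesses the coordinate of the point that owns the line
    seen; the guess on lines without an owner is arbitrary.\<close>
  proof (intro exI[of _ "\<lambda>i z. inv_into S h (i, z) i"] ballI)
    fix x assume x: "x \<in> S"
    then obtain i where "i \<in> I" "h x = (i, x(i := u))" using h(2) unfolding L_def by auto
    then show "\<exists>i\<in>I. inv_into S h (i, x(i := u)) i = x i"
      using inv_into_f_f[OF h(1) x] by metis
  qed
qed

section \<open>Neighbourhoods in the book graph\<close>

lemma doubleton_in_all_edges: "{u, v} \<in> all_edges V \<longleftrightarrow> u \<noteq> v \<and> u \<in> V \<and> v \<in> V"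
  unfolding all_edges_def by (cases "u = v") simp_all

lemma nbhd_book:
  "nbhd (book_verts d n) (book_edges d n) v =
    {u \<in> {0..<d + n}. u \<noteq> v \<and> v < d + n \<and> (u < d \<or> v < d)}"
  unfolding nbhd_def book_edges_def Diff_iff doubleton_in_all_edges book_verts_def by auto

lemma nbhd_book_page:
  "v \<in> {d..<d + n} \<Longrightarrow> nbhd (book_verts d n) (book_edges d n) v = {0..<d}"
  unfolding nbhd_book by auto

lemma nbhd_book_spine:
  "v < d \<Longrightarrow> nbhd (book_verts d n) (book_edges d n) v = {0..<d + n} - {v}"
  unfolding nbhd_book by auto

lemma card_le_imp_image_eq:
  assumes "finite A" "finite B" "B \<noteq> {}" "card B \<le> card A"
  shows "\<exists>g. g ` A = B"
  using card_le_inj[OF assms(2,1,4)] inj_on_iff_surj[OF assms(3)] by blast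

section \<open>Lower bound: a winning strategy with many pages\<close>

lemma players_win_book_fact:
  assumes "d \<ge> 1"
  shows "\<exists>n0. \<forall>n\<ge>n0. players_win (book_verts d n) (book_edges d n) (fact (d + 1))"
proof -
  define q :: nat where "q = fact (d + 1)"
  define X where "X = {0..<d} \<rightarrow>\<^sub>E {..<q}"
  define H where "H = X \<rightarrow>\<^sub>E {..<q}"
  have q0: "q > 0" unfolding q_def by simp
  have finX: "finite X" unfolding X_def by (intro finite_PiE) auto
  have finH: "finite H" unfolding H_def using finX by (intro finite_PiE) auto
  \<comment> \<open>With \<open>card H\<close> pages, every guessing function in \<open>H\<close> is
    used by some page; further pages may repeat functions.\<close>
  have "players_win (book_verts d n) (book_edges d n) q" if n: "n \<ge> card H" for n
  proof -
    let ?N = "nbhd (book_verts d n) (book_edges d n)"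
    have "H \<noteq> {}" unfolding H_def using q0 by (auto simp: PiE_eq_empty_iff)
    moreover have "card H \<le> card {d..<d + n}" using n by simp
    ultimately obtain g where g: "g ` {d..<d + n} = H"
      using finH card_le_imp_image_eq[of "{d..<d + n}" H] by auto
    \<comment> \<open>The spine colourings on which all pages err. The set depends only on the page
      hats, so every spine vertex can compute it.\<close>
    define surv where "surv c = {x \<in> X. \<forall>v\<in>{d..<d + n}. g v x \<noteq> c v}" for c :: "nat \<Rightarrow> nat"
    \<comment> \<open>If \<open>q\<close> colourings survived, some page would guess by a function mapping them onto all
      colours, and so would be right on one of them.\<close>
    have card_surv: "card (surv c) < q" if c: "\<forall>v\<in>{d..<d + n}. c v < q" for c
    proof (rule ccontr)
      assume "\<not> card (surv c) < q"
      then obtain h where h: "h ` surv c = {..<q}"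
        using finX q0 card_le_imp_image_eq[of "surv c" "{..<q}"] unfolding surv_def by auto
      \<comment> \<open>The value 0 off the survivors keeps \<open>h'\<close> inside
        \<open>H\<close>.\<close>
      define h' where "h' = (\<lambda>x\<in>X. if x \<in> surv c then h x else 0)"
      have "h x < q" if "x \<in> surv c" for x using h that by blast
      then have "h' \<in> H" unfolding H_def h'_def using q0 by auto
      then obtain v where v: "v \<in> {d..<d + n}" "g v = h'" using g by (metis imageE)
      have "c v \<in> {..<q}" using c v(1) by blast
      then obtain x where x: "x \<in> surv c" "h x = c v" using h by (metis imageE)
      then have "g v x = c v" unfolding v h'_def by (simp add: surv_def)
      then show False using x v unfolding surv_def by auto
    qed
    have surv_agree: "x j = y j" if "x \<in> surv c" "y \<in> surv c" "j \<notin> {0..<d}" for c x y j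
    proof -
      have "x \<in> X" "y \<in> X" using that unfolding surv_def by auto
      then show ?thesis using that(3) PiE_arb unfolding X_def by metis
    qed
    \<comment> \<open>The choice depends on the surviving set alone, so all spine vertices follow
      the same covering strategy.\<close>
    define F :: "(nat \<Rightarrow> nat) set \<Rightarrow> nat \<Rightarrow> (nat \<Rightarrow> nat) \<Rightarrow> nat" where
      "F S = (SOME f. \<forall>x\<in>S. \<exists>i\<in>{0..<d}. f i (x(i := undefined)) = x i)" for S
    have F: "\<exists>i\<in>{0..<d}. F (surv c) i (x(i := undefined)) = x i"
      if c: "\<forall>v\<in>{d..<d + n}. c v < q" and x: "x \<in> surv c" for c x
    proof -
      have "\<exists>f. \<forall>x\<in>surv c. \<exists>i\<in>{0..<d}. f i (x(i := undefined)) = x i"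
      proof (rule complete_graph_strategy)
        show "finite (surv c)" using finX unfolding surv_def by simp
        show "card (surv c) < fact (card {0..<d} + 1)"
          using card_surv[OF c] unfolding q_def by simp
        show "x j = y j" if "x \<in> surv c" "y \<in> surv c" "j \<notin> {0..<d}" for x y j
          using surv_agree[OF that] .
      qed (use assms in auto)
      then have "\<forall>x\<in>surv c. \<exists>i\<in>{0..<d}. F (surv c) i (x(i := undefined)) = x i"
        unfolding F_def by (rule someI_ex)
      then show ?thesis using x by blast
    qed
    \<comment> \<open>Capping at \<open>q - 1\<close> keeps every spine guess a legal colour and
      leaves correct guesses unchanged.\<close>
    define s where "s v y = (if v < d then min (F (surv y) v (restrict y {0..<d})) (q - 1) else g v y)"
      for v and y :: "nat \<Rightarrow> nat"
    show ?thesis unfolding players_win_def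
    proof (rule bexI[of _ s], rule ballI)
      show "s \<in> strategies (book_verts d n) (book_edges d n) q"
      proof -
        have "s v y < q" if v: "v \<in> book_verts d n" and y: "y \<in> ?N v \<rightarrow>\<^sub>E {..<q}" for v y
        proof (cases "v < d")
          case True
          then show ?thesis using q0 unfolding s_def by auto
        next
          case False
          then have v': "v \<in> {d..<d + n}" using v by (auto simp: book_verts_def)
          have "y \<in> X" using y nbhd_book_page[OF v'] unfolding X_def by simp
          moreover have "g v \<in> H" using g v' by blast
          ultimately show ?thesis using False unfolding H_def s_def by auto
        qed
        then show ?thesis unfolding strategies_def by (intro Pi_I) simp
      qed
      fix c assume c: "c \<in> book_verts d n \<rightarrow>\<^sub>E {..<q}"
      define x where "x = restrict c {0..<d}"
      have xX: "x \<in> X" using c unfolding X_def x_def book_verts_def by auto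
      have cq: "\<forall>v\<in>{d..<d + n}. c v < q" using c unfolding book_verts_def by (auto simp: PiE_iff)
      show "\<exists>v\<in>book_verts d n. s v (restrict c (?N v)) = c v"
      proof (cases "x \<in> surv c")
        case True
        then obtain i where i: "i < d" "F (surv c) i (x(i := undefined)) = x i"
          using F[OF cq True] by (metis atLeastLessThan_iff)
        let ?y = "restrict c ({0..<d + n} - {i})"
        have "surv ?y = surv c" unfolding surv_def using i(1) by auto
        moreover have "restrict ?y {0..<d} = x(i := undefined)"
          unfolding x_def using i(1) by (auto simp: fun_eq_iff)
        ultimately have "s i ?y = min (x i) (q - 1)" using i unfolding s_def by simp
        moreover have "x i = c i" using i(1) unfolding x_def by simp
        moreover have "c i < q" using c i(1) unfolding book_verts_def by (auto simp: PiE_iff)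
        ultimately have "s i (restrict c (?N i)) = c i" using nbhd_book_spine[OF i(1)] by simp
        then show ?thesis using i(1) by (auto simp: book_verts_def)
      next
        case False
        then obtain v where v: "v \<in> {d..<d + n}" "g v x = c v" using xX unfolding surv_def by auto
        then have "s v (restrict c (?N v)) = c v"
          using nbhd_book_page[OF v(1)] unfolding s_def x_def by auto
        then show ?thesis using v by (auto simp: book_verts_def)
      qed
    qed
  qed
  then show ?thesis unfolding q_def by blast
qed

section \<open>Upper bound: a box with more points than lines\<close>

lemma players_win_book_le:
  assumes "d \<ge> 1" and win: "players_win (book_verts d n) (book_edges d n) q"
  shows "q \<le> d ^ (d - 2) * (d ^ 2 + d - 1) + 1"
proof (rule ccontr)
  let ?N = "nbhd (book_verts d n) (book_edges d n)"
  define K where "K = d ^ (d - 2) * (d ^ 2 + d - 1)"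
  define side where "side j = (if j = d - 1 then d + 1 else d)" for j
  define box where "box I = (\<Pi>\<^sub>E j\<in>I. {..<side j})" for I
  \<comment> \<open>The axis-parallel lines meeting the box, each given by its direction and its
    remaining coordinates.\<close>
  define Lines where "Lines = (SIGMA i:{0..<d}. box ({0..<d} - {i}))"
  assume "\<not> q \<le> d ^ (d - 2) * (d ^ 2 + d - 1) + 1"
  then have q: "K + 1 < q" unfolding K_def by simp
  have card_box: "card (box I) = (\<Prod>j\<in>I. side j)" if "finite I" for I
    using that unfolding box_def by (simp add: card_PiE)
  have fin_box: "finite (box I)" if "finite I" for I
    using that unfolding box_def by (intro finite_PiE) auto
  have prod_side: "(\<Prod>j\<in>I. side j) = d ^ card I" if "d - 1 \<notin> I" for I
    using that unfolding side_def by (subst prod.cong[of I I _ "\<lambda>_. d"]) auto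
  have prod_side': "(\<Prod>j\<in>I. side j) = (d + 1) * d ^ (card I - 1)" if "finite I" "d - 1 \<in> I" for I
    using that by (subst prod.remove[OF that]) (simp add: prod_side, simp add: side_def)
  have "card Lines = (\<Sum>i\<in>{0..<d}. \<Prod>j\<in>{0..<d} - {i}. side j)"
    unfolding Lines_def using fin_box by (subst card_SigmaI) (auto simp: card_box)
  also have "\<dots> = (\<Prod>j\<in>{0..<d} - {d - 1}. side j)
      + (\<Sum>i\<in>{0..<d} - {d - 1}. \<Prod>j\<in>{0..<d} - {i}. side j)"
    using assms by (subst sum.remove[of _ "d - 1"]) auto
  also have "(\<Prod>j\<in>{0..<d} - {d - 1}. side j) = d ^ (d - 1)"
    using assms by (subst prod_side) auto
  also have "(\<Sum>i\<in>{0..<d} - {d - 1}. \<Prod>j\<in>{0..<d} - {i}. side j)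
      = (\<Sum>i\<in>{0..<d} - {d - 1}. (d + 1) * d ^ (d - 2))"
    using assms by (intro sum.cong refl, subst prod_side') (auto simp: numeral_2_eq_2)
  also have "\<dots> = (d - 1) * ((d + 1) * d ^ (d - 2))" using assms by simp
  also have "d ^ (d - 1) + (d - 1) * ((d + 1) * d ^ (d - 2)) = K"
  proof (cases "d = 1")
    case False
    then obtain e where "d = Suc (Suc e)" using assms by (metis Suc_le_D One_nat_def old.nat.exhaust)
    then show ?thesis unfolding K_def by (simp add: algebra_simps power2_eq_square)
  qed (simp add: K_def)
  finally have card_Lines: "card Lines = K" .
  have finL: "finite Lines" unfolding Lines_def using fin_box by auto
  \<comment> \<open>The right-hand side is the number of points of the box. For
    \<open>d \<ge> 2\<close> it exceeds \<open>K\<close> by \<open>d ^ (d - 2)\<close>; for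
    \<open>d = 1\<close>, where \<open>d - 2\<close> truncates to 0, it equals 2.\<close>
  have K: "K + 1 \<le> (d + 1) * d ^ (d - 1)"
  proof (cases "d = 1")
    case False
    then obtain e where e: "d = Suc (Suc e)" using assms by (metis Suc_le_D One_nat_def old.nat.exhaust)
    have "K + 1 \<le> K + d ^ (d - 2)" using e by simp
    also have "\<dots> = (d + 1) * d ^ (d - 1)"
      unfolding K_def using e by (simp add: algebra_simps power2_eq_square)
    finally show ?thesis .
  qed (simp add: K_def)
  have "d \<le> K"
  proof -
    have "1 \<le> d ^ 2" using assms by simp
    then have "d \<le> d ^ 2 + d - 1" by linarith
    also have "\<dots> \<le> K" unfolding K_def using assms by simp
    finally show ?thesis .
  qed
  then have side_q: "side j \<le> q" for j using q unfolding side_def by auto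
  have "card (box {0..<d}) = (d + 1) * d ^ (d - 1)"
    using assms by (subst card_box, simp, subst prod_side') auto
  then obtain T where T: "T \<subseteq> box {0..<d}" "card T = K + 1" "finite T"
    using K by (metis obtain_subset_with_card_n)
  have Tq: "x i < q" if "x \<in> T" "i < d" for x i
  proof -
    have "x \<in> box {0..<d}" using that T(1) by auto
    then have "x i < side i" using that(2) unfolding box_def by (auto simp: PiE_iff)
    then show ?thesis using side_q[of i] by simp
  qed
  obtain s where win: "\<And>c. c \<in> book_verts d n \<rightarrow>\<^sub>E {..<q} \<Longrightarrow>
      \<exists>v\<in>book_verts d n. s v (restrict c (?N v)) = c v"
    using win unfolding players_win_def by blast
  \<comment> \<open>On the \<open>K + 1 < q\<close> points of \<open>T\<close> a page guesses fewer
    than \<open>q\<close> colours. Giving it a missed colour \<open>p v\<close> makes it wrong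
    throughout \<open>T\<close>, so the spine alone must cover \<open>T\<close>.\<close>
  have "\<exists>p<q. p \<notin> s v ` T" for v
  proof (rule ccontr)
    assume "\<not> (\<exists>p<q. p \<notin> s v ` T)"
    then have "{..<q} \<subseteq> s v ` T" by auto
    then have "card {..<q} \<le> card T" using T(3) surj_card_le by blast
    then show False using T(2) q by simp
  qed
  then obtain p where p: "\<And>v. p v < q" "\<And>v. p v \<notin> s v ` T" by metis
  define col where "col x = (\<lambda>v\<in>{0..<d + n}. if v < d then x v else p v)" for x :: "nat \<Rightarrow> nat"
  have off_spine: "x j = undefined" if "x \<in> T" "\<not> j < d" for x j
    using PiE_arb[of x "{0..<d}" _ j] subsetD[OF T(1) that(1)] that(2) unfolding box_def by simp
  have hit: "\<exists>i<d. s i (restrict (col x) ({0..<d + n} - {i})) = x i" if x: "x \<in> T" for x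
  proof -
    have "col x \<in> book_verts d n \<rightarrow>\<^sub>E {..<q}"
      using p(1) Tq[OF x] unfolding col_def book_verts_def by auto
    from win[OF this] obtain v where v: "v < d + n" "s v (restrict (col x) (?N v)) = col x v"
      by (auto simp: book_verts_def)
    have "v < d"
    proof (rule ccontr)
      assume "\<not> v < d"
      then have v': "v \<in> {d..<d + n}" using v by auto
      have "restrict (col x) {0..<d} = x" using off_spine[OF x] unfolding col_def by (auto simp: fun_eq_iff)
      then have "s v x = p v" using v v' nbhd_book_page[OF v'] unfolding col_def by simp
      then show False using p(2)[of v] x by (metis imageI)
    qed
    then show ?thesis using v nbhd_book_spine[of v d n] unfolding col_def by auto
  qed
  then obtain i where i: "\<And>x. x \<in> T \<Longrightarrow> i x < d"
    "\<And>x. x \<in> T \<Longrightarrow> s (i x) (restrict (col x) ({0..<d + n} - {i x})) = x (i x)" by metis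
  \<comment> \<open>Two points of \<open>T\<close> on a common line in direction \<open>i x\<close>
    look alike to that spine vertex, which makes one guess for both. So each line accounts for at
    most one point.\<close>
  have "inj_on (\<lambda>x. (i x, x(i x := undefined))) T"
  proof (rule inj_onI)
    fix x y assume xy: "x \<in> T" "y \<in> T" "(i x, x(i x := undefined)) = (i y, y(i y := undefined))"
    have off: "x j = y j" if "j \<noteq> i x" for j
      using xy(3) that by (metis fun_upd_other prod.inject)
    have "restrict (col x) ({0..<d + n} - {i x}) = restrict (col y) ({0..<d + n} - {i x})"
      using off unfolding col_def by (auto simp: fun_eq_iff)
    then have "x (i x) = y (i x)" using i(2)[OF xy(1)] i(2)[OF xy(2)] xy(3) by simp
    then show "x = y" using off by (metis HOL.ext)
  qed
  moreover have "(\<lambda>x. (i x, x(i x := undefined))) ` T \<subseteq> Lines"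
  proof clarify
    fix x assume x: "x \<in> T"
    then have "x \<in> box (insert (i x) ({0..<d} - {i x}))"
      using T(1) i(1)[OF x] by (metis atLeast0LessThan insert_Diff lessThan_iff subsetD)
    then have "x(i x := undefined) \<in> box ({0..<d} - {i x})"
      unfolding box_def by (intro fun_upd_in_PiE) auto
    then show "(i x, x(i x := undefined)) \<in> Lines" using i(1)[OF x] unfolding Lines_def by auto
  qed
  ultimately have "card T \<le> card Lines" using finL card_inj_on_le by blast
  then show False using T(2) card_Lines by simp
qed

theorem theorem3:
  fixes d :: nat
  assumes "d \<ge> 1"
  shows "\<exists>n0::nat. \<forall>n\<ge>n0.
    fact (d + 1) \<le> HG (book_verts d n) (book_edges d n) \<and>
    HG (book_verts d n) (book_edges d n) \<le> d ^ (d - 2) * (d ^ 2 + d - 1) + 1"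
proof -
  obtain n0 where n0: "\<And>n. n \<ge> n0 \<Longrightarrow>
      players_win (book_verts d n) (book_edges d n) (fact (d + 1))"
    using players_win_book_fact[OF assms] by blast
  show ?thesis unfolding HG_def
  proof (intro exI allI impI conjI)
    fix n assume "n0 \<le> n"
    \<comment> \<open>The bound \<open>le\<close> on all winning \<open>q\<close> also guarantees
      that the greatest one exists.\<close>
    note win = n0[OF this] and le = players_win_book_le[OF assms]
    show "fact (d + 1) \<le> (GREATEST q. players_win (book_verts d n) (book_edges d n) q)"
      using win le by (rule Greatest_le_nat)
    show "(GREATEST q. players_win (book_verts d n) (book_edges d n) q)
        \<le> d ^ (d - 2) * (d ^ 2 + d - 1) + 1"
      by (rule le, rule GreatestI_nat) (use win le in blast)+
  qed
qed

end
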